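(* Let $A\in\mathbb{R}^{n\times n}$, $B\in\mathbb{R}^{n\times m}$, $C\in\mathbb{R}^{p\times n}$, $D\in\mathbb{R}^{p\times m}$, and let $Q=C^{T}C$, $S=C^{T}D$, $R=D^{T}D$. Let $X=X^{T}\in\mathbb{R}^{n\times n}$ be a solution of GDARE($\Sigma$). Then $\ker X$ is an output-nulling subspace of the quadruple $(A,B,C,D)$, i.e. $$\begin{bmatrix}A\\ C\end{bmatrix}\ker X\subseteq(\ker X\oplus 0_p)+\operatorname{im}\begin{bmatrix}B\\ D\end{bmatrix},$$ and $-K_X$ is a friend of $\ker X$, i.e. $$\begin{bmatrix}A-BK_X\\ C-DK_X\end{bmatrix}\ker X\subseteq\ker X\oplus 0_p.$$
   Context: $M^{\dagger}$ denotes the Moore-Penrose pseudo-inverse of $M$, and $0_p$ is the zero subspace of $\mathbb{R}^p$. With $\Sigma=(A,B;Q,R,S)$, $X=X^{T}$ is a solution of GDARE($\Sigma$) (generalised discrete algebraic Riccati equation) if $X=A^{T}XA-(A^{T}XB+S)(R+B^{T}XB)^{\dagger}(B^{T}XA+S^{T})+Q$ (no kernel constraint is imposed). The gain is $K_X=(R+B^{T}XB)^{\dagger}(B^{T}XA+S^{T})$. The matrices $C,D$ come from a factorisation $\begin{bmatrix}Q&S\\ S^{T}&R\end{bmatrix}=\begin{bmatrix}C^{T}\\ D^{T}\end{bmatrix}\begin{bmatrix}C&D\end{bmatrix}$ of the positive semidefinite Popov matrix. *)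

theory Defs
  imports "HOL-Analysis.Analysis"
begin

definition is_pinv :: "real^'n^'m \<Rightarrow> real^'m^'n \<Rightarrow> bool" where
  "is_pinv M P \<longleftrightarrow>
     M ** P ** M = M \<and> P ** M ** P = P \<and>
     transpose (M ** P) = M ** P \<and> transpose (P ** M) = P ** M"

text \<open>\<open>is_pinv M P\<close> lists the four Penrose conditions; the unique existence of such a \<open>P\<close>,
  which makes the description in \<open>pinv\<close> meaningful, is shown below.\<close>

definition pinv :: "real^'n^'m \<Rightarrow> real^'m^'n" where
  "pinv M = (THE P. is_pinv M P)"

lemma is_pinv_unique:
  assumes P: "is_pinv M P" and Q: "is_pinv M Q"
  shows "P = Q"
proof -
  have p: "M ** P ** M = M" "P ** M ** P = P"
      "transpose (M ** P) = M ** P" "transpose (P ** M) = P ** M"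
    and q: "M ** Q ** M = M" "Q ** M ** Q = Q"
      "transpose (M ** Q) = M ** Q" "transpose (Q ** M) = Q ** M"
    using P Q by (auto simp: is_pinv_def)
  have "M ** P = (M ** Q) ** (M ** P)"
    by (metis q(1) matrix_mul_assoc)
  also have "\<dots> = transpose ((M ** P) ** (M ** Q))"
    by (metis matrix_transpose_mul p(3) q(3))
  also have "\<dots> = M ** Q"
    by (metis p(1) q(3) matrix_mul_assoc)
  finally have MP: "M ** P = M ** Q" .
  have "P ** M = (P ** M) ** (Q ** M)"
    by (metis q(1) matrix_mul_assoc)
  also have "\<dots> = transpose ((Q ** M) ** (P ** M))"
    by (metis matrix_transpose_mul p(4) q(4))
  also have "\<dots> = Q ** M"
    by (metis p(1) q(4) matrix_mul_assoc)
  finally have PM: "P ** M = Q ** M" .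
  show "P = Q"
    by (metis MP PM p(2) q(2) matrix_mul_assoc)
qed

lemma is_pinv_exists:
  fixes M :: "real^'n^'m"
  shows "\<exists>P. is_pinv M P"
proof -
  define W where "W = {x. \<forall>z. M *v z = 0 \<longrightarrow> x \<bullet> z = 0}"
  have sR: "subspace (range ((*v) M))"
    by (intro linear_subspace_image subspace_UNIV matrix_vector_mul_linear)
  have sK: "subspace {z. M *v z = 0}"
    by (simp add: subspace_def matrix_vector_right_distrib matrix_vector_mult_scaleR)
  have ex: "\<exists>x. x \<in> W \<and> (\<forall>w. (y - M *v x) \<bullet> (M *v w) = 0)" for y
  proof -
    obtain u v where u: "u \<in> span (range ((*v) M))"
      and v: "\<And>w. w \<in> span (range ((*v) M)) \<Longrightarrow> orthogonal v w" and y: "y = u + v"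
      using orthogonal_subspace_decomp_exists[of "range ((*v) M)" y] by blast
    obtain x0 where x0: "u = M *v x0"
      using u sR by (metis imageE span_eq_iff)
    obtain a b where a: "a \<in> span {z. M *v z = 0}"
      and b: "\<And>w. w \<in> span {z. M *v z = 0} \<Longrightarrow> orthogonal b w" and x: "x0 = a + b"
      using orthogonal_subspace_decomp_exists[of "{z. M *v z = 0}" x0] by blast
    have "M *v a = 0"
      using a sK by (metis (mono_tags) mem_Collect_eq span_eq_iff)
    then have "u = M *v b"
      using x x0 by (simp add: matrix_vector_right_distrib)
    moreover have "b \<in> W"
      using b by (auto simp: W_def orthogonal_def span_base)
    moreover have "v \<bullet> (M *v w) = 0" for w
      using v[of "M *v w"] by (simp add: orthogonal_def span_base)
    ultimately show ?thesis
      using y by (intro exI[of _ b]) simp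
  qed
  have uniq: "x = x'" if "x \<in> W" "x' \<in> W"
    "\<forall>w. (y - M *v x) \<bullet> (M *v w) = 0" "\<forall>w. (y - M *v x') \<bullet> (M *v w) = 0" for x x' y
  proof -
    have "(M *v (x - x')) \<bullet> (M *v (x - x')) = 0"
      using that(3)[rule_format, of "x - x'"] that(4)[rule_format, of "x - x'"]
      by (simp add: matrix_vector_mult_diff_distrib inner_diff_left)
    then have "M *v (x - x') = 0" by simp
    then have "x \<bullet> (x - x') = 0" "x' \<bullet> (x - x') = 0"
      using that(1,2) by (auto simp: W_def)
    then have "(x - x') \<bullet> (x - x') = 0"
      by (simp add: inner_diff_left)
    then show ?thesis by simp
  qed
  obtain g where gW: "\<And>y. g y \<in> W" and g: "\<And>y w. (y - M *v g y) \<bullet> (M *v w) = 0"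
    using ex by metis
  have "linear g"
  proof (rule linearI)
    show "g (a + b) = g a + g b" for a b
    proof (rule uniq[of _ _ "a + b"])
      show "g a + g b \<in> W"
        using gW[of a] gW[of b] by (simp add: W_def inner_add_left)
      show "\<forall>w. (a + b - M *v (g a + g b)) \<bullet> (M *v w) = 0"
        using g[of a] g[of b]
        by (simp add: matrix_vector_right_distrib inner_add_left inner_diff_left)
    qed (use gW g in auto)
    show "g (c *\<^sub>R a) = c *\<^sub>R g a" for c a
    proof (rule uniq[of _ _ "c *\<^sub>R a"])
      show "c *\<^sub>R g a \<in> W"
        using gW[of a] by (simp add: W_def)
      show "\<forall>w. (c *\<^sub>R a - M *v (c *\<^sub>R g a)) \<bullet> (M *v w) = 0"
        using g[of a] by (simp add: matrix_vector_mult_scaleR inner_diff_left)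
    qed (use gW g in auto)
  qed
  define P where "P = matrix g"
  have Pg: "P *v y = g y" for y
    using \<open>linear g\<close> by (simp add: P_def matrix_works)
  have MPM: "M *v g (M *v x) = M *v x" for x
  proof -
    have "(M *v x - M *v g (M *v x)) \<bullet> (M *v x - M *v g (M *v x)) = 0"
      using g[of "M *v x" "x - g (M *v x)"] by (simp add: matrix_vector_mult_diff_distrib)
    then show ?thesis by simp
  qed
  have "M ** P ** M = M"
    by (simp add: matrix_eq Pg MPM flip: matrix_vector_mul_assoc)
  moreover have "P ** M ** P = P"
  proof -
    have "g (M *v g y) = g y" for y
      by (rule uniq[of _ _ "M *v g y"]) (use gW g in auto)
    then show ?thesis
      by (simp add: matrix_eq Pg flip: matrix_vector_mul_assoc)
  qed
  moreover have sym: "transpose N = N" if "\<And>x y. (N *v x) \<bullet> y = x \<bullet> (N *v y)" for N :: "real^'k^'k"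
  proof -
    have "x \<bullet> (transpose N *v y - N *v y) = 0" for x y
      using that[of x y] by (simp add: inner_diff_right dot_lmul_matrix flip: vector_transpose_matrix)
    then show ?thesis
      by (metis eq_iff_diff_eq_0 inner_eq_zero_iff matrix_eq)
  qed
  moreover have "transpose (M ** P) = M ** P"
  proof (rule sym)
    fix x y
    have "x \<bullet> (M *v g y) = (M *v g x) \<bullet> (M *v g y)" "y \<bullet> (M *v g x) = (M *v g y) \<bullet> (M *v g x)"
      using g[of x "g y"] g[of y "g x"] by (auto simp: inner_diff_left)
    then show "((M ** P) *v x) \<bullet> y = x \<bullet> ((M ** P) *v y)"
      by (simp add: Pg inner_commute flip: matrix_vector_mul_assoc)
  qed
  moreover have "transpose (P ** M) = P ** M"
  proof (rule sym)
    fix x y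
    have "g (M *v a) \<bullet> (b - g (M *v b)) = 0" for a b
      using gW[of "M *v a"] MPM[of b] by (simp add: W_def matrix_vector_mult_diff_distrib)
    from this[of x y] this[of y x] show "((P ** M) *v x) \<bullet> y = x \<bullet> ((P ** M) *v y)"
      by (simp add: Pg inner_diff_right inner_commute flip: matrix_vector_mul_assoc)
  qed
  ultimately show ?thesis
    unfolding is_pinv_def by blast
qed

lemma is_pinv_pinv: "is_pinv M (pinv M)"
  unfolding pinv_def using is_pinv_exists is_pinv_unique by (metis theI)

definition ker_mat :: "real^'n^'m \<Rightarrow> (real^'n) set" where
  "ker_mat M = {x. M *v x = 0}"

definition gain ::
  "real^'n^'n \<Rightarrow> real^'m^'n \<Rightarrow> real^'m^'m \<Rightarrow> real^'m^'n \<Rightarrow> real^'n^'n \<Rightarrow> real^'n^'m" where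
  "gain A B R S X =
     pinv (R + transpose B ** X ** B) ** (transpose B ** X ** A + transpose S)"

definition gdare ::
  "real^'n^'n \<Rightarrow> real^'m^'n \<Rightarrow> real^'n^'n \<Rightarrow> real^'m^'m \<Rightarrow> real^'m^'n \<Rightarrow> real^'n^'n \<Rightarrow> bool" where
  "gdare A B Q R S X \<longleftrightarrow>
     transpose X = X \<and>
     X = transpose A ** X ** A
         - (transpose A ** X ** B + S) ** pinv (R + transpose B ** X ** B)
             ** (transpose B ** X ** A + transpose S)
         + Q"

text \<open>The stacked matrix with blocks \<open>M\<close> over \<open>N\<close> is represented by the linear map
  \<open>x \<mapsto> (M x, N x)\<close> into the product space; accordingly \<open>V \<oplus> 0\<^sub>p\<close> is \<open>V \<times> {0}\<close>,
  and \<open>+\<close> on sets is the elementwise sum.\<close>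

definition stack :: "real^'k^'n \<Rightarrow> real^'k^'p \<Rightarrow> real^'k \<Rightarrow> (real^'n) \<times> (real^'p)" where
  "stack M N x = (M *v x, N *v x)"

definition output_nulling ::
  "real^'n^'n \<Rightarrow> real^'m^'n \<Rightarrow> real^'n^'p \<Rightarrow> real^'m^'p \<Rightarrow> (real^'n) set \<Rightarrow> bool" where
  "output_nulling A B C D V \<longleftrightarrow>
     subspace V \<and> stack A C ` V \<subseteq> V \<times> {0} + range (stack B D)"

definition is_friend ::
  "real^'n^'n \<Rightarrow> real^'m^'n \<Rightarrow> real^'n^'p \<Rightarrow> real^'m^'p \<Rightarrow> real^'n^'m \<Rightarrow> (real^'n) set \<Rightarrow> bool" where
  "is_friend A B C D F V \<longleftrightarrow> stack (A + B ** F) (C + D ** F) ` V \<subseteq> V \<times> {0}"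

lemma is_friend_uminus:
  fixes B :: "real^'m^'n" and D :: "real^'m^'p" and K :: "real^'n^'m"
  shows
  "is_friend A B C D (- K) V \<longleftrightarrow> stack (A - B ** K) (C - D ** K) ` V \<subseteq> V \<times> {0}"
proof -
  have "B ** (- K) = - (B ** K)" "D ** (- K) = - (D ** K)"
    by (simp_all add: matrix_matrix_mult_def vec_eq_iff sum_negf)
  then show ?thesis
    by (simp add: is_friend_def)
qed

end

theory Submission
  imports Defs "HOL-Computational_Algebra.Polynomial"
begin

text \<open>With \<open>F = A - B K\<close> and \<open>G = C - D K\<close> the Riccati equation becomes the Stein equation
  \<open>X = F\<^sup>T X F + G\<^sup>T G\<close>. Since \<open>X\<close> may be indefinite, \<open>ker X\<close> is treated through a resolvent:
  choose \<open>z\<close> on the unit circle with \<open>I - z F\<close> nonsingular. If \<open>y - z F y = x \<in> ker X\<close>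
  (complexified), then \<open>(F y)\<^sup>* X (F y) = y\<^sup>* X y\<close>, so \<open>G y = 0\<close>, whence
  \<open>X y = z\<^sup>* F\<^sup>T X y\<close> and thus \<open>X y = 0\<close>. Hence \<open>(I - z F)\<^sup>-\<^sup>1\<close> maps \<open>ker X\<close> into \<open>ker X \<inter> ker G\<close>,
  and by dimension onto \<open>ker X\<close>, so \<open>ker X\<close> is \<open>F\<close>-invariant and contained in \<open>ker G\<close>.\<close>

lemma poly_det: "poly (det M) z = det (\<chi> i j. poly (M $ i $ j) z)"
  for M :: "'a::comm_ring_1 poly^'n^'n"
  by (simp add: det_def poly_sum poly_prod)

text \<open>The determinant is a polynomial in \<open>z\<close> with value 1 at
  \<open>z = 0\<close>; being nonzero, it has finitely many roots.\<close>

lemma finite_zeros_det_mat_1_minus: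
  fixes A :: "'a::{idom,ring_char_0}^'n^'n"
  shows "finite {z. det (mat 1 - (\<chi> i j. z * A $ i $ j)) = 0}"
proof -
  define p where "p = det (\<chi> i j. [:mat 1 $ i $ j, - A $ i $ j:])"
  have p: "poly p z = det (mat 1 - (\<chi> i j. z * A $ i $ j))" for z
    unfolding p_def poly_det by (rule arg_cong[where f = det]) (simp add: vec_eq_iff)
  have "(mat 1 - (\<chi> i j. 0 * A $ i $ j)) = mat 1"
    by (simp add: vec_eq_iff)
  then have "poly p 0 = 1"
    by (simp only: p det_I)
  then have "p \<noteq> 0" by auto
  then show ?thesis
    using poly_roots_finite[of p] by (simp add: p)
qed

text \<open>A finite nonempty connected set is a singleton, but the circle contains both 1 and
  -1.\<close>

lemma infinite_unit_circle: "infinite (sphere (0::complex) 1)"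
proof
  assume "finite (sphere (0::complex) 1)"
  then obtain a where a: "sphere (0::complex) 1 = {a}"
    using connected_sphere[of "0::complex" 1] connected_finite_iff_sing[of "sphere (0::complex) 1"]
    by (auto simp: sphere_eq_empty)
  have "1 \<in> sphere (0::complex) 1" "-1 \<in> sphere (0::complex) 1" by auto
  then show False unfolding a by simp
qed

text \<open>The pair \<open>(y1, y2)\<close> stands for the complex vector \<open>y1 + i y2\<close>, so the two equations say
  \<open>y = z A y\<close>.\<close>

lemma ker_mat_1_minus_eq_0:
  fixes A :: "real^'n^'n"
  assumes det: "det (mat 1 - (\<chi> i j. z * complex_of_real (A $ i $ j))) \<noteq> 0"
    and y1: "y1 = Re z *\<^sub>R (A *v y1) - Im z *\<^sub>R (A *v y2)"
    and y2: "y2 = Im z *\<^sub>R (A *v y1) + Re z *\<^sub>R (A *v y2)"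
  shows "y1 = 0 \<and> y2 = 0"
proof -
  define M where "M = (\<chi> i j. z * complex_of_real (A $ i $ j))"
  define y where "y = (\<chi> i. Complex (y1 $ i) (y2 $ i))"
  have "M *v y = y"
  proof (subst vec_eq_iff, intro allI)
    fix i
    have "(M *v y) $ i = z * (\<Sum>j\<in>UNIV. complex_of_real (A $ i $ j) * Complex (y1 $ j) (y2 $ j))"
      by (simp add: matrix_vector_mult_def M_def y_def sum_distrib_left mult_ac)
    also have "(\<Sum>j\<in>UNIV. complex_of_real (A $ i $ j) * Complex (y1 $ j) (y2 $ j))
        = Complex ((A *v y1) $ i) ((A *v y2) $ i)"
      by (simp add: matrix_vector_mult_def complex_eq_iff)
    also have "z * \<dots> = Complex (y1 $ i) (y2 $ i)"
      using arg_cong[OF y1, of "\<lambda>v. v $ i"] arg_cong[OF y2, of "\<lambda>v. v $ i"]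
      by (simp add: complex_eq_iff)
    finally show "(M *v y) $ i = y $ i" by (simp add: y_def)
  qed
  then have "(mat 1 - M) *v y = 0"
    by (simp add: matrix_vector_mult_diff_rdistrib)
  moreover have "invertible (mat 1 - M)"
    using det invertible_det_nz by (metis M_def)
  ultimately have "y = 0"
    by (metis invertible_def matrix_left_invertible_ker)
  then show ?thesis
    by (simp add: vec_eq_iff y_def complex_eq_iff)
qed

lemma ker_stein:
  fixes X F :: "real^'n^'n" and G :: "real^'n^'p"
  assumes sym: "transpose X = X"
    and stein: "X = transpose F ** X ** F + transpose G ** G"
    and x: "X *v x = 0"
  shows "X *v (F *v x) = 0 \<and> G *v x = 0"
proof -
  let ?Z = "\<lambda>M :: real^'n^'n. {z. det (mat 1 - (\<chi> i j. z * (\<chi> i j. complex_of_real (M $ i $ j)) $ i $ j)) = 0}"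
  \<comment> \<open>One \<open>z\<close> must serve two resolvents: that of \<open>F\<close> at
    \<open>z\<close> and that of \<open>transpose F\<close> at \<open>cnj z\<close>, hence the image
    under \<open>cnj\<close>.\<close>
  have "finite (?Z F \<union> cnj ` ?Z (transpose F))"
    by (intro finite_UnI finite_imageI finite_zeros_det_mat_1_minus)
  then obtain z where z: "z \<in> sphere 0 1" "z \<notin> ?Z F" "z \<notin> cnj ` ?Z (transpose F)"
    using infinite_unit_circle by (meson UnCI ex_new_if_finite finite_subset subsetI)
  define c s where "c = Re z" and "s = Im z"
  have cs: "c^2 + s^2 = 1"
    using z(1) by (simp add: c_def s_def cmod_def)
  have inj1: "y1 = 0 \<and> y2 = 0"
    if "y1 = c *\<^sub>R (F *v y1) - s *\<^sub>R (F *v y2)" "y2 = s *\<^sub>R (F *v y1) + c *\<^sub>R (F *v y2)" for y1 y2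
    using ker_mat_1_minus_eq_0[of z F] z(2) that by (simp add: c_def s_def)
  have "cnj z \<notin> ?Z (transpose F)"
    using z(3) by (metis complex_cnj_cnj image_eqI)
  then have inj2: "y1 = 0 \<and> y2 = 0"
    if "y1 = c *\<^sub>R (transpose F *v y1) + s *\<^sub>R (transpose F *v y2)"
       "y2 = c *\<^sub>R (transpose F *v y2) - s *\<^sub>R (transpose F *v y1)" for y1 y2
    using ker_mat_1_minus_eq_0[of "cnj z" "transpose F"] that by (simp add: c_def s_def)
  have Xv: "X *v v = transpose F *v (X *v (F *v v)) + transpose G *v (G *v v)" for v
    by (subst stein) (simp add: matrix_vector_mult_add_rdistrib flip: matrix_vector_mul_assoc)
  have adj: "v \<bullet> (transpose M *v w) = (M *v v) \<bullet> w" for v w and M :: "real^'n^'k"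
    by (metis dot_lmul_matrix inner_commute vector_transpose_matrix transpose_transpose)
  have Xsym: "v \<bullet> (X *v w) = (X *v v) \<bullet> w" for v w
    using adj[of v X w] sym by simp
  \<comment> \<open>\<open>L\<close> is I - z F, acting on pairs of real and imaginary
    parts.\<close>
  define L where "L = (\<lambda>y. (fst y - (c *\<^sub>R (F *v fst y) - s *\<^sub>R (F *v snd y)),
                            snd y - (s *\<^sub>R (F *v fst y) + c *\<^sub>R (F *v snd y))))"
  define W where "W = ker_mat X \<times> ker_mat X"
  have "linear L"
    by (rule linearI) (simp_all add: L_def algebra_simps)
  moreover have "inj L"
    unfolding linear_injective_0[OF \<open>linear L\<close>] using inj1 by (auto simp: L_def prod_eq_iff)
  ultimately obtain T where T: "linear T" "\<And>v. T (L v) = v" "\<And>v. L (T v) = v"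
    using linear_injective_isomorphism[of L] by blast
  have key: "y \<in> W \<and> G *v fst y = 0" if "L y \<in> W" for y
  proof -
    obtain y1 y2 x1 x2 where y: "y = (y1, y2)" "L y = (x1, x2)"
      by fastforce
    have X12: "X *v x1 = 0" "X *v x2 = 0"
      using that y by (auto simp: W_def ker_mat_def)
    have e1: "c *\<^sub>R (F *v y1) - s *\<^sub>R (F *v y2) = y1 - x1"
      and e2: "s *\<^sub>R (F *v y1) + c *\<^sub>R (F *v y2) = y2 - x2"
      using y by (auto simp: L_def)
    \<comment> \<open>Multiplying z F y = y - x by conj(z), with |z| = 1, solves for F y = conj(z)
      (y - x).\<close>
    have "F *v y1 = (c^2 + s^2) *\<^sub>R (F *v y1)" "F *v y2 = (c^2 + s^2) *\<^sub>R (F *v y2)"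
      by (simp_all add: cs)
    moreover have "(c^2 + s^2) *\<^sub>R (F *v y1) = c *\<^sub>R (y1 - x1) + s *\<^sub>R (y2 - x2)"
      "(c^2 + s^2) *\<^sub>R (F *v y2) = c *\<^sub>R (y2 - x2) - s *\<^sub>R (y1 - x1)"
      unfolding e1[symmetric] e2[symmetric] by (simp_all add: algebra_simps power2_eq_square)
    ultimately have F1: "F *v y1 = c *\<^sub>R (y1 - x1) + s *\<^sub>R (y2 - x2)"
      and F2: "F *v y2 = c *\<^sub>R (y2 - x2) - s *\<^sub>R (y1 - x1)"
      by simp_all
    have XF1: "X *v (F *v y1) = c *\<^sub>R (X *v y1) + s *\<^sub>R (X *v y2)"
      and XF2: "X *v (F *v y2) = c *\<^sub>R (X *v y2) - s *\<^sub>R (X *v y1)"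
      unfolding F1 F2 by (simp_all add: algebra_simps X12)
    have 1: "v \<bullet> (X *v v) = (F *v v) \<bullet> (X *v (F *v v)) + (G *v v) \<bullet> (G *v v)" for v
      by (subst Xv) (simp add: inner_add_right adj del: transpose_matrix_vector)
    \<comment> \<open>All terms containing x drop out of the Hermitian form of \<open>X\<close> at F
      y, which leaves |z|^2 times the form at y. The Stein equation then forces |G y|^2 = 0.\<close>
    have orth: "x1 \<bullet> (X *v v) = 0" "x2 \<bullet> (X *v v) = 0" for v
      by (simp_all add: Xsym X12)
    have "(F *v y1) \<bullet> (X *v (F *v y1)) + (F *v y2) \<bullet> (X *v (F *v y2))
        = (c^2 + s^2) * (y1 \<bullet> (X *v y1) + y2 \<bullet> (X *v y2))"
      unfolding XF1 XF2 unfolding F1 F2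
      by (simp add: inner_add_left inner_add_right inner_diff_left inner_diff_right orth
        algebra_simps power2_eq_square)
    then have "(G *v y1) \<bullet> (G *v y1) + (G *v y2) \<bullet> (G *v y2) = 0"
      using 1[of y1] 1[of y2] cs by simp
    then have G: "G *v y1 = 0" "G *v y2 = 0"
      using inner_ge_zero[of "G *v y1"] inner_ge_zero[of "G *v y2"]
      by (metis add_nonneg_eq_0_iff inner_eq_zero_iff)+
    \<comment> \<open>With G y = 0 the Stein equation reads X y = F^T X F y = conj(z) F^T X y, so
      the second resolvent applies to X y.\<close>
    have "X *v y1 = c *\<^sub>R (transpose F *v (X *v y1)) + s *\<^sub>R (transpose F *v (X *v y2))"
      by (subst Xv) (simp add: G XF1 algebra_simps)
    moreover have "X *v y2 = c *\<^sub>R (transpose F *v (X *v y2)) - s *\<^sub>R (transpose F *v (X *v y1))"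
      by (subst Xv) (simp add: G XF2 algebra_simps)
    ultimately have "X *v y1 = 0 \<and> X *v y2 = 0"
      by (rule inj2)
    then show ?thesis
      using G y by (simp add: W_def ker_mat_def)
  qed
  have "subspace (ker_mat X)"
    by (simp add: ker_mat_def subspace_def algebra_simps)
  then have "subspace W"
    unfolding W_def by (rule subspace_Times) fact
  moreover have TW: "T ` W \<subseteq> W"
    using key by (metis T(3) image_subsetI)
  moreover have "subspace (T ` W)"
    using T(1) \<open>subspace W\<close> by (rule linear_subspace_image)
  moreover have "dim (T ` W) = dim W"
    by (rule dim_image_eq[OF T(1)]) (metis T(3) inj_on_def)
  \<comment> \<open>The injective \<open>T\<close> maps the finite-dimensional \<open>W\<close> into
    itself, hence onto itself; so its inverse \<open>L\<close> also preserves
    \<open>W\<close>.\<close>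
  ultimately have "T ` W = W"
    by (intro subspace_dim_equal) auto
  moreover have "(x, 0) \<in> W"
    using x by (simp add: W_def ker_mat_def)
  ultimately have "L (x, 0) \<in> W"
    using T(3) by (metis imageE)
  \<comment> \<open>\<open>key\<close> applies to \<open>(x, 0)\<close> itself, and the components
    of \<open>L (x, 0)\<close> are x - c F x and -s F x.\<close>
  then have "G *v x = 0" and "X *v (x - c *\<^sub>R (F *v x)) = 0" "X *v (0 - s *\<^sub>R (F *v x)) = 0"
    using key[of "(x, 0)"] by (auto simp: W_def L_def ker_mat_def algebra_simps)
  then have "c *\<^sub>R (X *v (F *v x)) = 0" "s *\<^sub>R (X *v (F *v x)) = 0"
    unfolding matrix_vector_mult_diff_distrib matrix_vector_mult_scaleR using x by simp_all
  moreover have "c \<noteq> 0 \<or> s \<noteq> 0"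
    using cs by auto
  ultimately show ?thesis
    using \<open>G *v x = 0\<close> by auto
qed

lemma transpose_add: "transpose (M + N) = transpose M + transpose N"
  by (simp add: transpose_def vec_eq_iff)

lemma transpose_diff: "transpose (M - N) = transpose M - transpose N"
  by (simp add: transpose_def vec_eq_iff)

text \<open>Transposing the Penrose conditions for a symmetric \<open>M\<close> permutes them, so
  uniqueness applies.\<close>

lemma transpose_pinv:
  assumes "transpose M = M"
  shows "transpose (pinv M) = pinv M"
proof (rule is_pinv_unique[OF _ is_pinv_pinv])
  show "is_pinv M (transpose (pinv M))"
    using is_pinv_pinv[of M] assms unfolding is_pinv_def
    by (metis matrix_mul_assoc matrix_transpose_mul)
qed

text \<open>With \<open>M\<close> and \<open>N\<close> as in the proof, the right-hand side expands
  to A^T X A + Q - N^T K - K^T N + K^T M K. The last two terms cancel because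
  \<open>pinv M ** M ** pinv M = pinv M\<close>.\<close>

lemma gdare_closed_loop:
  fixes A X :: "real^'n^'n" and B :: "real^'m^'n" and C :: "real^'n^'p" and D :: "real^'m^'p"
  assumes Q: "Q = transpose C ** C" and S: "S = transpose C ** D" and R: "R = transpose D ** D"
    and X: "gdare A B Q R S X"
  defines "K \<equiv> gain A B R S X"
  shows "X = transpose (A - B ** K) ** X ** (A - B ** K) + transpose (C - D ** K) ** (C - D ** K)"
proof -
  define M where "M = R + transpose B ** X ** B"
  define N where "N = transpose B ** X ** A + transpose S"
  have sym: "transpose X = X"
    using X by (simp add: gdare_def)
  have K: "K = pinv M ** N"
    by (simp add: K_def gain_def M_def N_def)
  have "transpose M = M"
    by (simp add: M_def R transpose_add matrix_transpose_mul sym matrix_mul_assoc)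
  then have "transpose K = transpose N ** pinv M"
    by (simp add: K matrix_transpose_mul transpose_pinv)
  then have "transpose K ** M ** K = transpose K ** N"
    using is_pinv_pinv[of M] unfolding K is_pinv_def by (metis matrix_mul_assoc)
  then have KMK: "transpose K *v (M *v (K *v v)) = transpose K *v (N *v v)" for v
    by (metis matrix_vector_mul_assoc)
  have "X = transpose A ** X ** A - (transpose A ** X ** B + S) ** K + Q"
    using X by (simp add: gdare_def K M_def N_def matrix_mul_assoc)
  then have Xv: "X *v v = (transpose A ** X ** A - (transpose A ** X ** B + S) ** K + Q) *v v" for v
    by simp
  show ?thesis
    unfolding matrix_eq
  proof
    fix v
    show "X *v v = (transpose (A - B ** K) ** X ** (A - B ** K) + transpose (C - D ** K) ** (C - D ** K)) *v v"
      using KMK[of v]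
      by (subst Xv) (simp add: M_def N_def Q R S transpose_diff matrix_transpose_mul algebra_simps
          flip: matrix_vector_mul_assoc)
  qed
qed

theorem theorem4p1:
  fixes A :: "real^'n^'n" and B :: "real^'m^'n" and C :: "real^'n^'p" and D :: "real^'m^'p"
    and Q X :: "real^'n^'n" and S :: "real^'m^'n" and R :: "real^'m^'m"
  assumes "Q = transpose C ** C" and "S = transpose C ** D" and "R = transpose D ** D"
    and "gdare A B Q R S X"
  shows "output_nulling A B C D (ker_mat X) \<and>
         is_friend A B C D (- gain A B R S X) (ker_mat X)"
proof -
  define K where "K = gain A B R S X"
  have sym: "transpose X = X"
    using assms(4) by (simp add: gdare_def)
  have ker: "X *v ((A - B ** K) *v x) = 0 \<and> (C - D ** K) *v x = 0" if "X *v x = 0" for x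
    using ker_stein[OF sym gdare_closed_loop[OF assms] that] by (simp add: K_def)
  have "is_friend A B C D (- K) (ker_mat X)"
    using ker by (auto simp: is_friend_uminus stack_def ker_mat_def)
  moreover have "stack A C x \<in> ker_mat X \<times> {0} + range (stack B D)" if "x \<in> ker_mat X" for x
  proof -
    \<comment> \<open>The friend property yields output nulling: \<open>K *v x\<close> is the input
      whose contribution is split off.\<close>
    have "stack A C x = stack (A - B ** K) (C - D ** K) x + stack B D (K *v x)"
      by (simp add: stack_def algebra_simps matrix_vector_mul_assoc)
    moreover have "stack (A - B ** K) (C - D ** K) x \<in> ker_mat X \<times> {0}"
      using ker that by (simp add: stack_def ker_mat_def)
    ultimately show ?thesis
      by (metis rangeI set_plus_intro)
  qed
  moreover have "subspace (ker_mat X)"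
    by (simp add: ker_mat_def subspace_def algebra_simps)
  ultimately show ?thesis
    by (auto simp: output_nulling_def K_def)
qed

end
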